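(* Let $A$ be an associative algebra, $M$ an $A$-bimodule and $(R,S)$ a generalized averaging system on $M$ over $A$. Then $M$ carries an associative dialgebra structure with products $u\dashv v=u\cdot S(v)$ and $u\vdash v=R(u)\cdot v$, for $u,v\in M$.
   Context: All vector spaces are over a field of characteristic zero. A pair $(R,S)$ of linear maps $M\to A$ is a generalized left averaging system if $R(u)R(v)=R(R(u)\cdot v)$ and $S(u)S(v)=S(R(u)\cdot v)$ for all $u,v\in M$; it is a generalized right averaging system if $R(u)R(v)=R(u\cdot S(v))$ and $S(u)S(v)=S(u\cdot S(v))$ for all $u,v\in M$. It is a generalized averaging system if it is both. An associative dialgebra is a vector space $D$ with bilinear maps $\dashv,\vdash:D\otimes D\to D$ such that for all $a,b,c\in D$: $a\dashv(b\dashv c)=(a\dashv b)\dashv c=a\dashv(b\vdash c)$; $(a\vdash b)\dashv c=a\vdash(b\dashv c)$; $(a\dashv b)\vdash c=a\vdash(b\vdash c)=(a\vdash b)\vdash c$. *)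

theory Defs
  imports Complex_Main
begin

text \<open>
  A vector space is a type of class \<^class>\<open>ab_group_add\<close> with a scalar multiplication
  satisfying the library locale \<^locale>\<open>vector_space\<close>; the ground field is a type of class
  \<^class>\<open>field_char_0\<close>. The scalar multiplications are written \<open>sA\<close>, \<open>sM\<close>, \<open>sD\<close>.
\<close>

text \<open>The library's own notion of bilinear map is restricted to real vector spaces.\<close>

definition bilinear_map ::
  "('k::field_char_0 \<Rightarrow> 'u::ab_group_add \<Rightarrow> 'u) \<Rightarrow> ('k \<Rightarrow> 'v::ab_group_add \<Rightarrow> 'v)
    \<Rightarrow> ('k \<Rightarrow> 'w::ab_group_add \<Rightarrow> 'w) \<Rightarrow> ('u \<Rightarrow> 'v \<Rightarrow> 'w) \<Rightarrow> bool" where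
  "bilinear_map s1 s2 s3 f \<longleftrightarrow>
    (\<forall>x. Vector_Spaces.linear s2 s3 (\<lambda>y. f x y)) \<and>
    (\<forall>y. Vector_Spaces.linear s1 s3 (\<lambda>x. f x y))"

text \<open>Associative algebras are not assumed to have a unit, hence no unit law in bimodules.\<close>

locale assoc_algebra = vector_space sA
  for sA :: "'k::field_char_0 \<Rightarrow> 'a::ab_group_add \<Rightarrow> 'a" +
  fixes mult :: "'a \<Rightarrow> 'a \<Rightarrow> 'a"
  assumes mult_bilinear: "bilinear_map sA sA sA mult"
    and mult_assoc: "mult (mult a b) c = mult a (mult b c)"

text \<open>\<open>lact a u\<close> is $a \cdot u$ and \<open>ract u a\<close> is $u \cdot a$.\<close>

locale bimodule = A: assoc_algebra sA mult + M: vector_space sM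
  for sA :: "'k::field_char_0 \<Rightarrow> 'a::ab_group_add \<Rightarrow> 'a"
    and mult :: "'a \<Rightarrow> 'a \<Rightarrow> 'a"
    and sM :: "'k \<Rightarrow> 'm::ab_group_add \<Rightarrow> 'm" +
  fixes lact :: "'a \<Rightarrow> 'm \<Rightarrow> 'm"
    and ract :: "'m \<Rightarrow> 'a \<Rightarrow> 'm"
  assumes lact_bilinear: "bilinear_map sA sM sM lact"
    and ract_bilinear: "bilinear_map sM sA sM ract"
    and lact_mult: "lact (mult a b) u = lact a (lact b u)"
    and ract_mult: "ract u (mult a b) = ract (ract u a) b"
    and lact_ract: "ract (lact a u) b = lact a (ract u b)"

locale generalized_left_averaging_system = bimodule sA mult sM lact ract
  for sA :: "'k::field_char_0 \<Rightarrow> 'a::ab_group_add \<Rightarrow> 'a"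
    and mult :: "'a \<Rightarrow> 'a \<Rightarrow> 'a"
    and sM :: "'k \<Rightarrow> 'm::ab_group_add \<Rightarrow> 'm"
    and lact :: "'a \<Rightarrow> 'm \<Rightarrow> 'm"
    and ract :: "'m \<Rightarrow> 'a \<Rightarrow> 'm" +
  fixes R S :: "'m \<Rightarrow> 'a"
  assumes R_linear: "Vector_Spaces.linear sM sA R"
    and S_linear: "Vector_Spaces.linear sM sA S"
    and R_left_averaging: "mult (R u) (R v) = R (lact (R u) v)"
    and S_left_averaging: "mult (S u) (S v) = S (lact (R u) v)"

locale generalized_right_averaging_system = bimodule sA mult sM lact ract
  for sA :: "'k::field_char_0 \<Rightarrow> 'a::ab_group_add \<Rightarrow> 'a"
    and mult :: "'a \<Rightarrow> 'a \<Rightarrow> 'a"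
    and sM :: "'k \<Rightarrow> 'm::ab_group_add \<Rightarrow> 'm"
    and lact :: "'a \<Rightarrow> 'm \<Rightarrow> 'm"
    and ract :: "'m \<Rightarrow> 'a \<Rightarrow> 'm" +
  fixes R S :: "'m \<Rightarrow> 'a"
  assumes R_linear: "Vector_Spaces.linear sM sA R"
    and S_linear: "Vector_Spaces.linear sM sA S"
    and R_right_averaging: "mult (R u) (R v) = R (ract u (S v))"
    and S_right_averaging: "mult (S u) (S v) = S (ract u (S v))"

locale generalized_averaging_system =
  generalized_left_averaging_system sA mult sM lact ract R S +
  right: generalized_right_averaging_system sA mult sM lact ract R S
  for sA :: "'k::field_char_0 \<Rightarrow> 'a::ab_group_add \<Rightarrow> 'a"
    and mult :: "'a \<Rightarrow> 'a \<Rightarrow> 'a"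
    and sM :: "'k \<Rightarrow> 'm::ab_group_add \<Rightarrow> 'm"
    and lact :: "'a \<Rightarrow> 'm \<Rightarrow> 'm"
    and ract :: "'m \<Rightarrow> 'a \<Rightarrow> 'm"
    and R S :: "'m \<Rightarrow> 'a"

locale assoc_dialgebra = vector_space sD
  for sD :: "'k::field_char_0 \<Rightarrow> 'd::ab_group_add \<Rightarrow> 'd" +
  fixes dleft :: "'d \<Rightarrow> 'd \<Rightarrow> 'd" (infixl "\<stileturn>" 70)
    and dright :: "'d \<Rightarrow> 'd \<Rightarrow> 'd" (infixl "\<turnstile>" 70)
  assumes dleft_bilinear: "bilinear_map sD sD sD (\<stileturn>)"
    and dright_bilinear: "bilinear_map sD sD sD (\<turnstile>)"
    and dleft_assoc: "a \<stileturn> (b \<stileturn> c) = (a \<stileturn> b) \<stileturn> c"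
    and dleft_dright: "(a \<stileturn> b) \<stileturn> c = a \<stileturn> (b \<turnstile> c)"
    and dright_dleft_assoc: "(a \<turnstile> b) \<stileturn> c = a \<turnstile> (b \<stileturn> c)"
    and dleft_dright_dright: "(a \<stileturn> b) \<turnstile> c = a \<turnstile> (b \<turnstile> c)"
    and dright_assoc: "a \<turnstile> (b \<turnstile> c) = (a \<turnstile> b) \<turnstile> c"

end

theory Submission
  imports Defs
begin

text \<open>Writing -| and |- for the two products on M, the four averaging identities say that
  \<open>R\<close> and \<open>S\<close> are each multiplicative for both: R(u -| v) = R(u)R(v) = R(u
  |- v), and likewise for \<open>S\<close>. The module laws turn two successive actions on the same
  side into one action of a product in A, so four of the dialgebra identities each need one
  averaging identity and one module law. The fifth, with |- inside and -| outside, is just the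
  commutation of the left and right actions. Bilinearity survives precomposing one argument with a
  linear map.\<close>

lemma bilinear_map_compose_left:
  assumes f: "bilinear_map s1 s2 s3 f" and g: "Vector_Spaces.linear s0 s1 g"
  shows "bilinear_map s0 s2 s3 (\<lambda>x y. f (g x) y)"
  using f Vector_Spaces.linear_compose[OF g]
  unfolding bilinear_map_def o_def by blast

lemma bilinear_map_compose_right:
  assumes f: "bilinear_map s1 s2 s3 f" and g: "Vector_Spaces.linear s0 s2 g"
  shows "bilinear_map s1 s0 s3 (\<lambda>x y. f x (g y))"
  using f Vector_Spaces.linear_compose[OF g]
  unfolding bilinear_map_def o_def by blast

theorem proposition5p14:
  fixes sA :: "'k::field_char_0 \<Rightarrow> 'a::ab_group_add \<Rightarrow> 'a"
    and mult :: "'a \<Rightarrow> 'a \<Rightarrow> 'a"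
    and sM :: "'k \<Rightarrow> 'm::ab_group_add \<Rightarrow> 'm"
    and lact :: "'a \<Rightarrow> 'm \<Rightarrow> 'm"
    and ract :: "'m \<Rightarrow> 'a \<Rightarrow> 'm"
    and R S :: "'m \<Rightarrow> 'a"
  assumes "assoc_algebra sA mult"
    and "bimodule sA mult sM lact ract"
    and "generalized_averaging_system sA mult sM lact ract R S"
  shows "assoc_dialgebra sM (\<lambda>u v. ract u (S v)) (\<lambda>u v. lact (R u) v)"
proof -
  interpret generalized_averaging_system sA mult sM lact ract R S
    by fact
  show ?thesis
  proof
    show "bilinear_map sM sM sM (\<lambda>u v. ract u (S v))"
      by (rule bilinear_map_compose_right[OF ract_bilinear S_linear])
    show "bilinear_map sM sM sM (\<lambda>u v. lact (R u) v)"
      by (rule bilinear_map_compose_left[OF lact_bilinear R_linear])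
    fix u v w
    \<comment> \<open>Here and in the next identity, the flipped rules bring both sides to
      \<open>ract u (mult (S v) (S w))\<close>: \<open>S\<close> of either product of
      \<open>v\<close> and \<open>w\<close> is the same element of A.\<close>
    show "ract u (S (ract v (S w))) = ract (ract u (S v)) (S w)"
      by (simp flip: right.S_right_averaging ract_mult)
    show "ract (ract u (S v)) (S w) = ract u (S (lact (R v) w))"
      by (simp flip: S_left_averaging ract_mult)
    show "ract (lact (R u) v) (S w) = lact (R u) (ract v (S w))"
      by (rule lact_ract)
    \<comment> \<open>Mirror image with \<open>R\<close>: in this and the last identity both sides
      become \<open>lact (mult (R u) (R v)) w\<close>.\<close>
    show "lact (R (ract u (S v))) w = lact (R u) (lact (R v) w)"
      by (simp flip: right.R_right_averaging lact_mult)
    show "lact (R u) (lact (R v) w) = lact (R (lact (R u) v)) w"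
      by (simp flip: R_left_averaging lact_mult)
  qed
qed

end
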